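(* Let $p$ be a prime number, let $\xi$ be an irrational $p$-adic number, and let $((x_{k}^{\times}, y_{k}^{\times}))_{k \ge 1}$ be its sequence of multiplicative best approximations. Assume that at least one of the following two claims holds: (i) there exist $c > 0$ and arbitrarily large $k$ such that $|x_{k}^{\times}|\ge c |y_{k}^{\times}|$ and $|x_{k+1}^{\times}|\ge c |y_{k+1}^{\times}|$; (ii) there exist $c > 0$ and arbitrarily large $k$ such that $|x_{k}^{\times}|\le c |y_{k}^{\times}|$ and $|x_{k+1}^{\times}|\le c |y_{k+1}^{\times}|$. Then $\widehat{\mu}^{\times}(\xi) \leq 3$.
   Context: $|\cdot|_p$ is the $p$-adic absolute value with $|p|_p=p^{-1}$. The sequence of multiplicative best approximations $((x_{k}^{\times},y_{k}^{\times}))_{k \ge 1}$ of $\xi$ is obtained as follows: for a real $X>0$, consider the pair of coprime nonzero integers $(x,y)$ minimizing $|y\xi - x|_p$ among all integer pairs with $0<\sqrt{|xy|}\le X$; letting $X$ grow to infinity, the distinct pairs so obtained, listed in order of appearance, form the sequence. Writing $Q_k^\times = \sqrt{|x_k^\times y_k^\times|}$, one has $Q_1^\times<Q_2^\times<\cdots$ and $|y_1^\times\xi-x_1^\times|_p>|y_2^\times\xi-x_2^\times|_p>\cdots$. $\widehat{\mu}^{\times}(\xi)$ is the supremum of the real numbers $\widehat{\mu}^\times$ such that for every sufficiently large real $X$ the system $0 < |xy|^{1/2} \le X$, $|y\xi - x|_p \le X^{-\widehat{\mu}^\times}$ has a solution in integers $x,y$. *)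

theory Defs
  imports
    "HOL-Algebra.QuotRing"
    "HOL-Computational_Algebra.Primes"
    "HOL-Library.Extended_Real"
begin

section \<open>The field of p-adic numbers\<close>

definition padic_abs :: "nat \<Rightarrow> rat \<Rightarrow> real" where
  "padic_abs p r =
     (if r = 0 then 0
      else real p powi (int (multiplicity (int p) (snd (quotient_of r)))
                        - int (multiplicity (int p) (fst (quotient_of r)))))"

definition padic_Cauchy :: "nat \<Rightarrow> (nat \<Rightarrow> rat) \<Rightarrow> bool" where
  "padic_Cauchy p s \<longleftrightarrow> (\<forall>e>0. \<exists>N. \<forall>m\<ge>N. \<forall>n\<ge>N. padic_abs p (s m - s n) < e)"

definition Cauchy_ring :: "nat \<Rightarrow> (nat \<Rightarrow> rat) ring" where
  "Cauchy_ring p =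
     \<lparr>carrier = {s. padic_Cauchy p s},
      monoid.mult = (\<lambda>s t n. s n * t n), one = (\<lambda>n. 1),
      zero = (\<lambda>n. 0), add = (\<lambda>s t n. s n + t n)\<rparr>"

definition null_seqs :: "nat \<Rightarrow> (nat \<Rightarrow> rat) set" where
  "null_seqs p = {s. (\<lambda>n. padic_abs p (s n)) \<longlonglongrightarrow> 0}"

text \<open>The completion of the rationals with respect to \<^term>\<open>padic_abs p\<close>.\<close>

definition Qp :: "nat \<Rightarrow> (nat \<Rightarrow> rat) set ring" where
  "Qp p = Cauchy_ring p Quot null_seqs p"

definition Qp_of_rat :: "nat \<Rightarrow> rat \<Rightarrow> (nat \<Rightarrow> rat) set" where
  "Qp_of_rat p r = null_seqs p +>\<^bsub>Cauchy_ring p\<^esub> (\<lambda>n. r)"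

text \<open>
  The continuous extension of \<^term>\<open>padic_abs p\<close>; an element of \<^term>\<open>Qp p\<close> is the set of all
  rational Cauchy sequences converging to it.
\<close>

definition Qp_abs :: "nat \<Rightarrow> (nat \<Rightarrow> rat) set \<Rightarrow> real" where
  "Qp_abs p a = (THE l. \<forall>s\<in>a. (\<lambda>n. padic_abs p (s n)) \<longlonglongrightarrow> l)"


subsection \<open>Basic properties\<close>

lemma padic_abs_0 [simp]: "padic_abs p 0 = 0"
  by (simp add: padic_abs_def)

lemma padic_abs_nonneg: "padic_abs p r \<ge> 0"
  by (simp add: padic_abs_def)

lemma padic_abs_eq_0_iff: "prime p \<Longrightarrow> padic_abs p r = 0 \<longleftrightarrow> r = 0"
  by (auto simp: padic_abs_def prime_gt_0_nat)

lemma padic_abs_divide: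
  assumes p: "prime p" and a: "a \<noteq> 0" and b: "b \<noteq> 0"
  shows "padic_abs p (of_int a / of_int b) =
           real p powi (int (multiplicity (int p) b) - int (multiplicity (int p) a))"
proof -
  define r :: rat where "r = of_int a / of_int b"
  obtain n d where nd: "quotient_of r = (n, d)" by force
  have d: "d > 0" using quotient_of_denom_pos[OF nd] .
  have rnd: "r = of_int n / of_int d" using quotient_of_div[OF nd] .
  have r0: "r \<noteq> 0" using a b by (simp add: r_def)
  hence n: "n \<noteq> 0" using rnd by auto
  have "of_int (a * d) = (of_int (n * b) :: rat)"
    using rnd b d unfolding r_def by (simp add: field_simps)
  hence eq: "a * d = n * b" by (simp only: of_int_eq_iff)
  have pr: "prime_elem (int p)" using p by simp
  have "multiplicity (int p) a + multiplicity (int p) d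
          = multiplicity (int p) n + multiplicity (int p) b"
    using prime_elem_multiplicity_mult_distrib[OF pr, of a d]
      prime_elem_multiplicity_mult_distrib[OF pr, of n b] eq a b n d by simp
  hence "int (multiplicity (int p) d) - int (multiplicity (int p) n)
          = int (multiplicity (int p) b) - int (multiplicity (int p) a)" by linarith
  thus ?thesis using r0 nd unfolding r_def[symmetric] padic_abs_def by simp
qed

lemma padic_abs_of_int:
  assumes "prime p" "a \<noteq> 0"
  shows "padic_abs p (of_int a) = 1 / real p ^ multiplicity (int p) a"
  using padic_abs_divide[OF assms, of 1] assms
  by (simp add: power_int_minus field_simps)

lemma padic_abs_prime:
  assumes "prime p"
  shows "padic_abs p (of_nat p) = 1 / real p"
proof -
  have "multiplicity (int p) (int p) = 1"
    using assms by (intro multiplicity_prime) auto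
  thus ?thesis
    using padic_abs_of_int[OF assms, of "int p"] assms by (auto simp: prime_gt_0_nat)
qed

lemma padic_abs_1 [simp]: "padic_abs p 1 = 1"
  by (simp add: padic_abs_def)

lemma padic_abs_mult:
  assumes p: "prime p"
  shows "padic_abs p (r * s) = padic_abs p r * padic_abs p s"
proof (cases "r = 0 \<or> s = 0")
  case True
  thus ?thesis by auto
next
  case False
  obtain a b where r: "r = of_int a / of_int b" "b \<noteq> 0"
    using quotient_of_div[of r] quotient_of_denom_pos[of r]
    by (metis less_irrefl surj_pair)
  obtain c d where s: "s = of_int c / of_int d" "d \<noteq> 0"
    using quotient_of_div[of s] quotient_of_denom_pos[of s]
    by (metis less_irrefl surj_pair)
  have ac: "a \<noteq> 0" "c \<noteq> 0" using False r s by auto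
  have pr: "prime_elem (int p)" using p by simp
  have rs: "r * s = of_int (a * c) / of_int (b * d)" using r s by simp
  have "padic_abs p (r * s) = real p powi (int (multiplicity (int p) (b * d))
          - int (multiplicity (int p) (a * c)))"
    unfolding rs using ac r s by (intro padic_abs_divide[OF p]) auto
  also have "\<dots> = real p powi ((int (multiplicity (int p) b) - int (multiplicity (int p) a))
        + (int (multiplicity (int p) d) - int (multiplicity (int p) c)))"
    using prime_elem_multiplicity_mult_distrib[OF pr, of a c]
      prime_elem_multiplicity_mult_distrib[OF pr, of b d] ac r s
    by (simp add: algebra_simps)
  also have "\<dots> = padic_abs p r * padic_abs p s"
    using p padic_abs_divide[OF p ac(1) r(2)] padic_abs_divide[OF p ac(2) s(2)]
    unfolding r(1) s(1) by (subst power_int_add) (auto simp: prime_gt_0_nat)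
  finally show ?thesis .
qed

lemma padic_abs_minus:
  assumes "prime p" shows "padic_abs p (- r) = padic_abs p r"
proof -
  have "padic_abs p (-1) * padic_abs p (-1) = 1"
    using padic_abs_mult[OF assms, of "-1" "-1"] by simp
  hence "padic_abs p (-1) = 1"
    using padic_abs_nonneg[of p "-1"] by (smt (verit) mult_cancel_left1 square_eq_1_iff)
  thus ?thesis using padic_abs_mult[OF assms, of "-1" r] by simp
qed

lemma padic_abs_inverse:
  assumes "prime p" shows "padic_abs p (inverse r) = inverse (padic_abs p r)"
proof (cases "r = 0")
  case False
  have "padic_abs p r * padic_abs p (inverse r) = 1"
    using padic_abs_mult[OF assms, of r "inverse r"] False by simp
  thus ?thesis by (metis inverse_unique)
qed simp

lemma padic_abs_add:
  assumes p: "prime p"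
  shows "padic_abs p (r + s) \<le> max (padic_abs p r) (padic_abs p s)"
proof -
  have key: "padic_abs p (of_int a + of_int b) \<le> max (padic_abs p (of_int a)) (padic_abs p (of_int b))"
    for a b :: int
  proof (cases "a = 0 \<or> b = 0 \<or> a + b = 0")
    case True
    moreover have "padic_abs p (of_int a + of_int b) = 0" if "a + b = 0"
      using that by (metis of_int_add of_int_0 padic_abs_0)
    ultimately show ?thesis
      by (auto simp: padic_abs_nonneg le_max_iff_disj)
  next
    case False
    define m where "m = min (multiplicity (int p) a) (multiplicity (int p) b)"
    have "int p ^ m dvd a" "int p ^ m dvd b"
      unfolding m_def by (auto intro: multiplicity_dvd')
    hence "int p ^ m dvd a + b" by simp
    hence "m \<le> multiplicity (int p) (a + b)"
      using False p by (intro multiplicity_geI) (auto simp: not_prime_1)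
    hence "real p ^ m \<le> real p ^ multiplicity (int p) (a + b)"
      using prime_gt_0_nat[OF p] by (intro power_increasing) auto
    hence "padic_abs p (of_int (a + b)) \<le> 1 / real p ^ m"
      using False p by (subst padic_abs_of_int) (auto intro!: divide_left_mono simp: prime_gt_0_nat)
    also have "\<dots> \<le> max (padic_abs p (of_int a)) (padic_abs p (of_int b))"
      using False p by (auto simp: padic_abs_of_int m_def min_def max_def)
    finally show ?thesis by simp
  qed
  obtain a b where r: "r = of_int a / of_int b" "b \<noteq> 0"
    using quotient_of_div[of r] quotient_of_denom_pos[of r]
    by (metis less_irrefl surj_pair)
  obtain c d where s: "s = of_int c / of_int d" "d \<noteq> 0"
    using quotient_of_div[of s] quotient_of_denom_pos[of s]
    by (metis less_irrefl surj_pair)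
  define w :: rat where "w = inverse (of_int (b * d))"
  have w: "r = of_int (a * d) * w" "s = of_int (c * b) * w"
    using r s by (auto simp: w_def field_simps)
  hence "r + s = (of_int (a * d) + of_int (c * b)) * w" by (simp add: algebra_simps)
  hence "padic_abs p (r + s) = padic_abs p (of_int (a * d) + of_int (c * b)) * padic_abs p w"
    using padic_abs_mult[OF p] by metis
  also have "\<dots> \<le> max (padic_abs p (of_int (a * d))) (padic_abs p (of_int (c * b))) * padic_abs p w"
    using key[of "a * d" "c * b"] padic_abs_nonneg by (intro mult_right_mono) auto
  also have "\<dots> = max (padic_abs p r) (padic_abs p s)"
    unfolding w padic_abs_mult[OF p] using padic_abs_nonneg[of p w]
    by (simp add: max_mult_distrib_right)
  finally show ?thesis .
qed

lemma padic_abs_diff_le: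
  assumes "prime p" shows "padic_abs p (r - s) \<le> max (padic_abs p r) (padic_abs p s)"
  using padic_abs_add[OF assms, of r "- s"] padic_abs_minus[OF assms] by simp

lemma padic_abs_triangle:
  assumes "prime p" shows "\<bar>padic_abs p r - padic_abs p s\<bar> \<le> padic_abs p (r - s)"
  using padic_abs_add[OF assms, of "r - s" s] padic_abs_add[OF assms, of "s - r" r]
    padic_abs_minus[OF assms, of "r - s"]
    padic_abs_nonneg[of p "r - s"] padic_abs_nonneg[of p r] padic_abs_nonneg[of p s]
  by (auto simp: max_def split: if_splits)

lemma padic_Cauchy_const [simp]: "padic_Cauchy p (\<lambda>n. r)"
  by (simp add: padic_Cauchy_def)

lemma padic_Cauchy_convergent:
  assumes "prime p" "padic_Cauchy p s"
  shows "convergent (\<lambda>n. padic_abs p (s n))"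
proof -
  have "Cauchy (\<lambda>n. padic_abs p (s n))"
  proof (rule metric_CauchyI)
    fix e :: real assume "e > 0"
    then obtain N where N: "\<And>m n. m \<ge> N \<Longrightarrow> n \<ge> N \<Longrightarrow> padic_abs p (s m - s n) < e"
      using assms(2) unfolding padic_Cauchy_def by blast
    have "dist (padic_abs p (s m)) (padic_abs p (s n)) < e" if "m \<ge> N" "n \<ge> N" for m n
      using padic_abs_triangle[OF assms(1), of "s m" "s n"] N[OF that]
      by (simp add: dist_real_def)
    thus "\<exists>M. \<forall>m\<ge>M. \<forall>n\<ge>M. dist (padic_abs p (s m)) (padic_abs p (s n)) < e" by blast
  qed
  thus ?thesis by (simp add: Cauchy_convergent_iff)
qed

lemma padic_Cauchy_bounded:
  assumes "prime p" "padic_Cauchy p s"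
  obtains B where "B > 0" "\<And>n. padic_abs p (s n) \<le> B"
proof -
  have "Bseq (\<lambda>n. padic_abs p (s n))"
    using padic_Cauchy_convergent[OF assms] by (rule convergent_imp_Bseq)
  then obtain B where "B > 0" "\<And>n. norm (padic_abs p (s n)) \<le> B"
    by (rule BseqE) blast
  thus ?thesis using that by (simp add: padic_abs_nonneg)
qed

lemma padic_Cauchy_add:
  assumes p: "prime p" and s: "padic_Cauchy p s" and t: "padic_Cauchy p t"
  shows "padic_Cauchy p (\<lambda>n. s n + t n)"
  unfolding padic_Cauchy_def
proof (intro allI impI)
  fix e :: real assume "e > 0"
  obtain M N where "\<And>m n. m \<ge> M \<Longrightarrow> n \<ge> M \<Longrightarrow> padic_abs p (s m - s n) < e"
    "\<And>m n. m \<ge> N \<Longrightarrow> n \<ge> N \<Longrightarrow> padic_abs p (t m - t n) < e"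
    using s t \<open>e > 0\<close> unfolding padic_Cauchy_def by meson
  hence "padic_abs p (s m + t m - (s n + t n)) < e" if "m \<ge> max M N" "n \<ge> max M N" for m n
    using that padic_abs_add[OF p, of "s m - s n" "t m - t n"]
    by (smt (verit, del_insts) add_diff_add max.bounded_iff)
  thus "\<exists>N. \<forall>m\<ge>N. \<forall>n\<ge>N. padic_abs p (s m + t m - (s n + t n)) < e" by blast
qed

lemma padic_Cauchy_uminus:
  assumes p: "prime p" and s: "padic_Cauchy p s"
  shows "padic_Cauchy p (\<lambda>n. - s n)"
proof -
  have "padic_abs p (- s m + s n) = padic_abs p (s m - s n)" for m n
    using padic_abs_minus[OF p, of "s m - s n"] by simp
  thus ?thesis using s by (simp add: padic_Cauchy_def)
qed

lemma padic_Cauchy_mult: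
  assumes p: "prime p" and s: "padic_Cauchy p s" and t: "padic_Cauchy p t"
  shows "padic_Cauchy p (\<lambda>n. s n * t n)"
  unfolding padic_Cauchy_def
proof (intro allI impI)
  fix e :: real assume "e > 0"
  obtain A where A: "A > 0" "\<And>n. padic_abs p (s n) \<le> A"
    using padic_Cauchy_bounded[OF p s] by metis
  obtain B where B: "B > 0" "\<And>n. padic_abs p (t n) \<le> B"
    using padic_Cauchy_bounded[OF p t] by metis
  obtain M N where M: "\<And>m n. m \<ge> M \<Longrightarrow> n \<ge> M \<Longrightarrow> padic_abs p (s m - s n) < e / B"
    and N: "\<And>m n. m \<ge> N \<Longrightarrow> n \<ge> N \<Longrightarrow> padic_abs p (t m - t n) < e / A"
    using s t \<open>e > 0\<close> A(1) B(1) unfolding padic_Cauchy_def by (meson divide_pos_pos)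
  have "padic_abs p (s m * t m - s n * t n) < e" if mn: "m \<ge> max M N" "n \<ge> max M N" for m n
  proof -
    have "s m * t m - s n * t n = (s m - s n) * t m + s n * (t m - t n)"
      by (simp add: algebra_simps)
    hence "padic_abs p (s m * t m - s n * t n)
        \<le> max (padic_abs p (s m - s n) * padic_abs p (t m)) (padic_abs p (s n) * padic_abs p (t m - t n))"
      using padic_abs_add[OF p] padic_abs_mult[OF p] by metis
    moreover have "padic_abs p (s m - s n) * padic_abs p (t m) < e"
    proof -
      have "padic_abs p (s m - s n) * padic_abs p (t m) \<le> padic_abs p (s m - s n) * B"
        using B padic_abs_nonneg by (intro mult_left_mono) auto
      also have "\<dots> < e" using M[of m n] mn B by (simp add: field_simps)
      finally show ?thesis .
    qed
    moreover have "padic_abs p (s n) * padic_abs p (t m - t n) < e"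
    proof -
      have "padic_abs p (s n) * padic_abs p (t m - t n) \<le> A * padic_abs p (t m - t n)"
        using A padic_abs_nonneg by (intro mult_right_mono) auto
      also have "\<dots> < e" using N[of m n] mn A by (simp add: field_simps)
      finally show ?thesis .
    qed
    ultimately show ?thesis by linarith
  qed
  thus "\<exists>N. \<forall>m\<ge>N. \<forall>n\<ge>N. padic_abs p (s m * t m - s n * t n) < e" by blast
qed

lemma Cauchy_ring_simps [simp]:
  "carrier (Cauchy_ring p) = {s. padic_Cauchy p s}"
  "s \<otimes>\<^bsub>Cauchy_ring p\<^esub> t = (\<lambda>n. s n * t n)"
  "s \<oplus>\<^bsub>Cauchy_ring p\<^esub> t = (\<lambda>n. s n + t n)"
  "\<one>\<^bsub>Cauchy_ring p\<^esub> = (\<lambda>n. 1)"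
  "\<zero>\<^bsub>Cauchy_ring p\<^esub> = (\<lambda>n. 0)"
  by (simp_all add: Cauchy_ring_def)

lemma cring_Cauchy_ring:
  assumes p: "prime p"
  shows "cring (Cauchy_ring p)"
proof (rule cringI)
  show "abelian_group (Cauchy_ring p)"
  proof (rule abelian_groupI)
    fix s assume "s \<in> carrier (Cauchy_ring p)"
    thus "\<exists>t\<in>carrier (Cauchy_ring p). t \<oplus>\<^bsub>Cauchy_ring p\<^esub> s = \<zero>\<^bsub>Cauchy_ring p\<^esub>"
      using padic_Cauchy_uminus[OF p] by (intro bexI[of _ "\<lambda>n. - s n"]) auto
  qed (simp_all add: padic_Cauchy_add[OF p] Groups.add_ac)
  show "comm_monoid (Cauchy_ring p)"
    by (rule comm_monoidI) (simp_all add: padic_Cauchy_mult[OF p] Groups.mult_ac)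
qed (simp add: ring_distribs)

lemma null_imp_padic_Cauchy:
  assumes p: "prime p" and "s \<in> null_seqs p"
  shows "padic_Cauchy p s"
  unfolding padic_Cauchy_def
proof (intro allI impI)
  fix e :: real assume "e > 0"
  then obtain N where N: "\<And>n. n \<ge> N \<Longrightarrow> padic_abs p (s n) < e"
    using assms(2) LIMSEQ_D[of "\<lambda>n. padic_abs p (s n)" 0 e]
    by (auto simp: null_seqs_def padic_abs_nonneg)
  have "padic_abs p (s m - s n) < e" if "m \<ge> N" "n \<ge> N" for m n
    using padic_abs_diff_le[OF p, of "s m" "s n"] N[OF that(1)] N[OF that(2)] by linarith
  thus "\<exists>N. \<forall>m\<ge>N. \<forall>n\<ge>N. padic_abs p (s m - s n) < e" by blast
qed

lemma null_seqs_add: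
  assumes p: "prime p" and s: "s \<in> null_seqs p" and t: "t \<in> null_seqs p"
  shows "(\<lambda>n. s n + t n) \<in> null_seqs p"
proof -
  have "(\<lambda>n. max (padic_abs p (s n)) (padic_abs p (t n))) \<longlonglongrightarrow> max 0 0"
    using s t by (intro tendsto_max) (simp_all add: null_seqs_def)
  hence lim: "(\<lambda>n. max (padic_abs p (s n)) (padic_abs p (t n))) \<longlonglongrightarrow> 0" by simp
  have "(\<lambda>n. padic_abs p (s n + t n)) \<longlonglongrightarrow> 0"
    by (rule tendsto_sandwich[OF _ _ tendsto_const lim])
       (intro always_eventually allI padic_abs_nonneg padic_abs_add[OF p])+
  thus ?thesis by (simp add: null_seqs_def)
qed

lemma null_seqs_mult:
  assumes p: "prime p" and s: "padic_Cauchy p s" and t: "t \<in> null_seqs p"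
  shows "(\<lambda>n. s n * t n) \<in> null_seqs p"
proof -
  obtain l where "(\<lambda>n. padic_abs p (s n)) \<longlonglongrightarrow> l"
    using padic_Cauchy_convergent[OF p s] by (auto simp: convergent_def)
  hence "(\<lambda>n. padic_abs p (s n) * padic_abs p (t n)) \<longlonglongrightarrow> l * 0"
    using t by (intro tendsto_mult) (auto simp: null_seqs_def)
  thus ?thesis by (simp add: null_seqs_def padic_abs_mult[OF p])
qed

lemma ideal_null_seqs:
  assumes p: "prime p"
  shows "ideal (null_seqs p) (Cauchy_ring p)"
proof -
  interpret cring "Cauchy_ring p" by (rule cring_Cauchy_ring[OF p])
  have inv: "\<ominus>\<^bsub>Cauchy_ring p\<^esub> s = (\<lambda>n. - s n)" if "padic_Cauchy p s" for s
    using that padic_Cauchy_uminus[OF p that] by (intro minus_equality) auto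
  show ?thesis
  proof (rule idealI)
    show "subgroup (null_seqs p) (add_monoid (Cauchy_ring p))"
    proof (rule add.subgroupI)
      show "null_seqs p \<subseteq> carrier (Cauchy_ring p)"
        using null_imp_padic_Cauchy[OF p] by auto
      have "(\<lambda>n. 0) \<in> null_seqs p" by (simp add: null_seqs_def)
      thus "null_seqs p \<noteq> {}" by blast
      fix s assume s: "s \<in> null_seqs p"
      show "\<ominus>\<^bsub>Cauchy_ring p\<^esub> s \<in> null_seqs p"
        using s inv[OF null_imp_padic_Cauchy[OF p s]]
        by (auto simp: null_seqs_def padic_abs_minus[OF p])
    qed (auto simp: null_seqs_add[OF p])
  next
    fix a x assume ax: "a \<in> null_seqs p" "x \<in> carrier (Cauchy_ring p)"
    show "x \<otimes>\<^bsub>Cauchy_ring p\<^esub> a \<in> null_seqs p" using ax null_seqs_mult[OF p] by simp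
    thus "a \<otimes>\<^bsub>Cauchy_ring p\<^esub> x \<in> null_seqs p" using m_comm[of a x] ax null_imp_padic_Cauchy[OF p] by auto
  qed (rule ring_axioms)
qed

lemma cring_Qp:
  assumes "prime p"
  shows "cring (Qp p)"
  unfolding Qp_def
  by (rule ideal.quotient_is_cring[OF ideal_null_seqs cring_Cauchy_ring]) (fact assms)+

lemma padic_coset_eq:
  "null_seqs p +>\<^bsub>Cauchy_ring p\<^esub> s = {t. (\<lambda>n. t n - s n) \<in> null_seqs p}"
proof safe
  fix t assume "(\<lambda>n. t n - s n) \<in> null_seqs p"
  thus "t \<in> null_seqs p +>\<^bsub>Cauchy_ring p\<^esub> s"
    unfolding a_r_coset_def r_coset_def by (auto intro!: bexI[of _ "\<lambda>n. t n - s n"])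
qed (auto simp: a_r_coset_def r_coset_def)

lemma carrier_QpE:
  assumes "a \<in> carrier (Qp p)"
  obtains s where "padic_Cauchy p s" "a = null_seqs p +>\<^bsub>Cauchy_ring p\<^esub> s"
  using assms by (auto simp: Qp_def FactRing_def A_RCOSETS_def')

lemma coset_in_carrier_Qp:
  "padic_Cauchy p s \<Longrightarrow> null_seqs p +>\<^bsub>Cauchy_ring p\<^esub> s \<in> carrier (Qp p)"
  by (auto simp: Qp_def FactRing_def A_RCOSETS_def')

lemma Qp_add_coset:
  assumes p: "prime p" and "padic_Cauchy p s" "padic_Cauchy p t"
  shows "(null_seqs p +>\<^bsub>Cauchy_ring p\<^esub> s) \<oplus>\<^bsub>Qp p\<^esub> (null_seqs p +>\<^bsub>Cauchy_ring p\<^esub> t)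
           = null_seqs p +>\<^bsub>Cauchy_ring p\<^esub> (\<lambda>n. s n + t n)"
proof -
  interpret ideal "null_seqs p" "Cauchy_ring p" by (rule ideal_null_seqs[OF p])
  show ?thesis using a_rcos_sum[of s t] assms by (simp add: Qp_def FactRing_def)
qed

lemma Qp_mult_coset:
  assumes p: "prime p" and "padic_Cauchy p s" "padic_Cauchy p t"
  shows "(null_seqs p +>\<^bsub>Cauchy_ring p\<^esub> s) \<otimes>\<^bsub>Qp p\<^esub> (null_seqs p +>\<^bsub>Cauchy_ring p\<^esub> t)
           = null_seqs p +>\<^bsub>Cauchy_ring p\<^esub> (\<lambda>n. s n * t n)"
proof -
  interpret ideal "null_seqs p" "Cauchy_ring p" by (rule ideal_null_seqs[OF p])
  show ?thesis using rcoset_mult_add[of s t] assms by (simp add: Qp_def FactRing_def)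
qed

lemma Qp_zero_coset: "\<zero>\<^bsub>Qp p\<^esub> = null_seqs p +>\<^bsub>Cauchy_ring p\<^esub> (\<lambda>n. 0)"
  by (simp add: Qp_def FactRing_def padic_coset_eq)

lemma Qp_one_coset: "\<one>\<^bsub>Qp p\<^esub> = null_seqs p +>\<^bsub>Cauchy_ring p\<^esub> (\<lambda>n. 1)"
  by (simp add: Qp_def FactRing_def)

lemma Qp_uminus_coset:
  assumes p: "prime p" and s: "padic_Cauchy p s"
  shows "\<ominus>\<^bsub>Qp p\<^esub> (null_seqs p +>\<^bsub>Cauchy_ring p\<^esub> s) = null_seqs p +>\<^bsub>Cauchy_ring p\<^esub> (\<lambda>n. - s n)"
proof -
  interpret cring "Qp p" by (rule cring_Qp[OF p])
  show ?thesis
    using Qp_add_coset[OF p padic_Cauchy_uminus[OF p s] s] s padic_Cauchy_uminus[OF p s]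
    by (intro minus_equality) (auto simp: coset_in_carrier_Qp Qp_zero_coset)
qed

lemma Qp_abs_tendsto:
  assumes p: "prime p" and s: "padic_Cauchy p s"
  shows "(\<lambda>n. padic_abs p (s n)) \<longlonglongrightarrow> Qp_abs p (null_seqs p +>\<^bsub>Cauchy_ring p\<^esub> s)"
proof -
  obtain l where l: "(\<lambda>n. padic_abs p (s n)) \<longlonglongrightarrow> l"
    using padic_Cauchy_convergent[OF p s] by (auto simp: convergent_def)
  have all: "(\<lambda>n. padic_abs p (t n)) \<longlonglongrightarrow> l" if "t \<in> null_seqs p +>\<^bsub>Cauchy_ring p\<^esub> s" for t
  proof -
    have 0: "(\<lambda>n. padic_abs p (t n - s n)) \<longlonglongrightarrow> 0"
      using that unfolding padic_coset_eq by (simp add: null_seqs_def)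
    have "(\<lambda>n. padic_abs p (t n) - padic_abs p (s n)) \<longlonglongrightarrow> 0"
      by (rule tendsto_rabs_zero_cancel, rule tendsto_sandwich[OF _ _ tendsto_const 0])
         (auto simp: padic_abs_triangle[OF p])
    from tendsto_add[OF this l] show ?thesis by simp
  qed
  have self: "s \<in> null_seqs p +>\<^bsub>Cauchy_ring p\<^esub> s" unfolding padic_coset_eq by (simp add: null_seqs_def)
  have "Qp_abs p (null_seqs p +>\<^bsub>Cauchy_ring p\<^esub> s) = l"
    unfolding Qp_abs_def
    by (rule the_equality) (use all self LIMSEQ_unique[OF _ l] in blast)+
  thus ?thesis using l by simp
qed

lemma Qp_abs_of_rat:
  assumes "prime p"
  shows "Qp_abs p (Qp_of_rat p r) = padic_abs p r"
  using Qp_abs_tendsto[OF assms, of "\<lambda>n. r"] unfolding Qp_of_rat_def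
  by (simp add: LIMSEQ_const_iff)

lemma Qp_abs_mult:
  assumes p: "prime p" and "a \<in> carrier (Qp p)" "b \<in> carrier (Qp p)"
  shows "Qp_abs p (a \<otimes>\<^bsub>Qp p\<^esub> b) = Qp_abs p a * Qp_abs p b"
proof -
  obtain s where s: "padic_Cauchy p s" "a = null_seqs p +>\<^bsub>Cauchy_ring p\<^esub> s"
    using assms carrier_QpE by metis
  obtain t where t: "padic_Cauchy p t" "b = null_seqs p +>\<^bsub>Cauchy_ring p\<^esub> t"
    using assms carrier_QpE by metis
  show ?thesis
    unfolding s(2) t(2) Qp_mult_coset[OF p s(1) t(1)]
    by (rule LIMSEQ_unique[OF Qp_abs_tendsto[OF p padic_Cauchy_mult[OF p s(1) t(1)]]],
        unfold padic_abs_mult[OF p],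
        rule tendsto_mult[OF Qp_abs_tendsto[OF p s(1)] Qp_abs_tendsto[OF p t(1)]])
qed

lemma Qp_abs_add:
  assumes p: "prime p" and "a \<in> carrier (Qp p)" "b \<in> carrier (Qp p)"
  shows "Qp_abs p (a \<oplus>\<^bsub>Qp p\<^esub> b) \<le> max (Qp_abs p a) (Qp_abs p b)"
proof -
  obtain s where s: "padic_Cauchy p s" "a = null_seqs p +>\<^bsub>Cauchy_ring p\<^esub> s"
    using assms carrier_QpE by metis
  obtain t where t: "padic_Cauchy p t" "b = null_seqs p +>\<^bsub>Cauchy_ring p\<^esub> t"
    using assms carrier_QpE by metis
  show ?thesis
    unfolding s(2) t(2) Qp_add_coset[OF p s(1) t(1)]
    by (rule LIMSEQ_le[OF Qp_abs_tendsto[OF p padic_Cauchy_add[OF p s(1) t(1)]]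
          tendsto_max[OF Qp_abs_tendsto[OF p s(1)] Qp_abs_tendsto[OF p t(1)]]])
       (intro exI allI impI padic_abs_add[OF p])
qed

lemma Qp_abs_nonneg:
  assumes p: "prime p" and a: "a \<in> carrier (Qp p)"
  shows "Qp_abs p a \<ge> 0"
proof -
  obtain s where s: "padic_Cauchy p s" "a = null_seqs p +>\<^bsub>Cauchy_ring p\<^esub> s"
    using a carrier_QpE by metis
  show ?thesis unfolding s(2)
    by (rule tendsto_lowerbound[OF Qp_abs_tendsto[OF p s(1)]]) (auto simp: padic_abs_nonneg)
qed

lemma Qp_abs_eq_0_iff:
  assumes p: "prime p" and a: "a \<in> carrier (Qp p)"
  shows "Qp_abs p a = 0 \<longleftrightarrow> a = \<zero>\<^bsub>Qp p\<^esub>"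
proof -
  obtain s where s: "padic_Cauchy p s" "a = null_seqs p +>\<^bsub>Cauchy_ring p\<^esub> s"
    using a carrier_QpE by metis
  have "Qp_abs p a = 0 \<longleftrightarrow> s \<in> null_seqs p"
    using Qp_abs_tendsto[OF p s(1)] LIMSEQ_unique by (auto simp: null_seqs_def s(2))
  moreover have "s \<in> null_seqs p \<longleftrightarrow> a = \<zero>\<^bsub>Qp p\<^esub>"
  proof
    assume sn: "s \<in> null_seqs p"
    interpret ideal "null_seqs p" "Cauchy_ring p" by (rule ideal_null_seqs[OF p])
    show "a = \<zero>\<^bsub>Qp p\<^esub>" using a_rcos_const[OF sn] by (simp add: s Qp_def FactRing_def)
  next
    assume "a = \<zero>\<^bsub>Qp p\<^esub>"
    moreover have "s \<in> a" unfolding s padic_coset_eq by (simp add: null_seqs_def)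
    ultimately show "s \<in> null_seqs p" by (simp add: Qp_def FactRing_def)
  qed
  ultimately show ?thesis by simp
qed

theorem field_Qp:
  assumes p: "prime p"
  shows "field (Qp p)"
proof (rule cring.cring_fieldI2[OF cring_Qp[OF p]])
  have "Qp_abs p \<one>\<^bsub>Qp p\<^esub> = 1"
    using Qp_abs_of_rat[OF p, of 1] by (simp add: Qp_of_rat_def Qp_one_coset)
  moreover have "Qp_abs p \<zero>\<^bsub>Qp p\<^esub> = 0"
    using Qp_abs_of_rat[OF p, of 0] by (simp add: Qp_of_rat_def Qp_zero_coset)
  ultimately show "\<zero>\<^bsub>Qp p\<^esub> \<noteq> \<one>\<^bsub>Qp p\<^esub>" by auto
next
  fix a assume a: "a \<in> carrier (Qp p)" "a \<noteq> \<zero>\<^bsub>Qp p\<^esub>"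
  obtain s where s: "padic_Cauchy p s" "a = null_seqs p +>\<^bsub>Cauchy_ring p\<^esub> s"
    using a(1) carrier_QpE by metis
  define l where "l = Qp_abs p a"
  have l: "l > 0" using a Qp_abs_nonneg[OF p a(1)] Qp_abs_eq_0_iff[OF p a(1)] by (simp add: l_def)
  have lim: "(\<lambda>n. padic_abs p (s n)) \<longlonglongrightarrow> l" unfolding l_def s(2) by (rule Qp_abs_tendsto[OF p s(1)])
  have "eventually (\<lambda>n. padic_abs p (s n) > l / 2) sequentially"
    using order_tendstoD(1)[OF lim, of "l / 2"] l by simp
  then obtain K where K: "\<And>n. n \<ge> K \<Longrightarrow> padic_abs p (s n) > l / 2"
    by (auto simp: eventually_sequentially)
  have nz: "s n \<noteq> 0" if "n \<ge> K" for n using K[OF that] l by auto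
  have cau: "padic_Cauchy p (\<lambda>n. inverse (s n))"
    unfolding padic_Cauchy_def
  proof (intro allI impI)
    fix e :: real assume "e > 0"
    then obtain M where M: "\<And>m n. m \<ge> M \<Longrightarrow> n \<ge> M \<Longrightarrow> padic_abs p (s m - s n) < e * (l / 2 * (l / 2))"
      using s(1) l unfolding padic_Cauchy_def by (meson half_gt_zero mult_pos_pos)
    have "padic_abs p (inverse (s m) - inverse (s n)) < e" if mn: "m \<ge> max K M" "n \<ge> max K M" for m n
    proof -
      have "inverse (s m) - inverse (s n) = (s n - s m) * inverse (s m * s n)"
        using nz[of m] nz[of n] mn by (simp add: field_simps)
      hence eq: "padic_abs p (inverse (s m) - inverse (s n))
          = padic_abs p (s n - s m) / (padic_abs p (s m) * padic_abs p (s n))"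
        by (simp only: padic_abs_mult[OF p] padic_abs_inverse[OF p] divide_inverse)
      have "l / 2 * (l / 2) \<le> padic_abs p (s m) * padic_abs p (s n)"
        using K[of m] K[of n] mn l by (intro mult_mono) auto
      hence "e * (l / 2 * (l / 2)) \<le> e * (padic_abs p (s m) * padic_abs p (s n))"
        using \<open>e > 0\<close> by (intro mult_left_mono) auto
      hence "padic_abs p (s n - s m) < e * (padic_abs p (s m) * padic_abs p (s n))"
        using M[of n m] mn by auto
      moreover have "padic_abs p (s m) * padic_abs p (s n) > 0"
        using K[of m] K[of n] mn l by (intro mult_pos_pos) auto
      ultimately show ?thesis unfolding eq by (simp add: pos_divide_less_eq)
    qed
    thus "\<exists>N. \<forall>m\<ge>N. \<forall>n\<ge>N. padic_abs p (inverse (s m) - inverse (s n)) < e" by blast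
  qed
  define b where "b = null_seqs p +>\<^bsub>Cauchy_ring p\<^esub> (\<lambda>n. inverse (s n))"
  have b: "b \<in> carrier (Qp p)" unfolding b_def by (rule coset_in_carrier_Qp[OF cau])
  have nul: "(\<lambda>n. s n * inverse (s n) - 1) \<in> null_seqs p"
    unfolding null_seqs_def mem_Collect_eq
    by (rule tendsto_eventually) (use nz in \<open>auto simp: eventually_sequentially intro!: exI[of _ K]\<close>)
  have "a \<otimes>\<^bsub>Qp p\<^esub> b = null_seqs p +>\<^bsub>Cauchy_ring p\<^esub> (\<lambda>n. s n * inverse (s n))"
    unfolding s(2) b_def by (rule Qp_mult_coset[OF p s(1) cau])
  also have "\<dots> = \<one>\<^bsub>Qp p\<^esub>"
  proof -
    interpret ideal "null_seqs p" "Cauchy_ring p" by (rule ideal_null_seqs[OF p])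
    have "(\<lambda>n. s n * inverse (s n)) \<in> null_seqs p +>\<^bsub>Cauchy_ring p\<^esub> (\<lambda>n. 1)"
      using nul by (simp add: padic_coset_eq)
    from a_repr_independence[OF this _ is_additive_subgroup[THEN additive_subgroup.a_subgroup]]
    show ?thesis by (simp add: Qp_one_coset)
  qed
  finally show "\<exists>b\<in>carrier (Qp p). a \<otimes>\<^bsub>Qp p\<^esub> b = \<one>\<^bsub>Qp p\<^esub>" using b by blast
qed

text \<open>
  Density of the rationals and completeness: together with \<open>field_Qp\<close> and \<open>Qp_abs_of_rat\<close>, these
  characterise the field of p-adic numbers.
\<close>

lemma Qp_minus_coset:
  assumes p: "prime p" and s: "padic_Cauchy p s" and t: "padic_Cauchy p t"
  shows "(null_seqs p +>\<^bsub>Cauchy_ring p\<^esub> s) \<ominus>\<^bsub>Qp p\<^esub> (null_seqs p +>\<^bsub>Cauchy_ring p\<^esub> t)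
           = null_seqs p +>\<^bsub>Cauchy_ring p\<^esub> (\<lambda>n. s n - t n)"
  using Qp_add_coset[OF p s padic_Cauchy_uminus[OF p t]]
  by (simp add: a_minus_def Qp_uminus_coset[OF p t])

lemma Qp_dense:
  assumes p: "prime p" and a: "a \<in> carrier (Qp p)" and e: "e > 0"
  obtains r where "Qp_abs p (a \<ominus>\<^bsub>Qp p\<^esub> Qp_of_rat p r) < e"
proof -
  obtain s where s: "padic_Cauchy p s" "a = null_seqs p +>\<^bsub>Cauchy_ring p\<^esub> s"
    using a carrier_QpE by metis
  obtain N where N: "\<And>m n. m \<ge> N \<Longrightarrow> n \<ge> N \<Longrightarrow> padic_abs p (s m - s n) < e / 2"
    using s(1) e unfolding padic_Cauchy_def by (meson half_gt_zero)
  have "padic_Cauchy p (\<lambda>n. s n - s N)"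
    using padic_Cauchy_add[OF p s(1) padic_Cauchy_const[of p "- s N"]] by simp
  from Qp_abs_tendsto[OF p this]
  have "(\<lambda>n. padic_abs p (s n - s N)) \<longlonglongrightarrow> Qp_abs p (a \<ominus>\<^bsub>Qp p\<^esub> Qp_of_rat p (s N))"
    unfolding s(2) Qp_of_rat_def Qp_minus_coset[OF p s(1) padic_Cauchy_const] .
  hence "Qp_abs p (a \<ominus>\<^bsub>Qp p\<^esub> Qp_of_rat p (s N)) \<le> e / 2"
    by (rule LIMSEQ_le_const2) (use N in \<open>auto intro!: exI[of _ N] less_imp_le\<close>)
  thus ?thesis using that[of "s N"] e by simp
qed

lemma Qp_complete:
  assumes p: "prime p" and a: "\<And>n. a n \<in> carrier (Qp p)"
    and Cau: "\<And>e. e > 0 \<Longrightarrow> \<exists>N. \<forall>m\<ge>N. \<forall>n\<ge>N. Qp_abs p (a m \<ominus>\<^bsub>Qp p\<^esub> a n) < e"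
  obtains l where "l \<in> carrier (Qp p)" "(\<lambda>n. Qp_abs p (a n \<ominus>\<^bsub>Qp p\<^esub> l)) \<longlonglongrightarrow> 0"
proof -
  interpret cring "Qp p" by (rule cring_Qp[OF p])
  have rat [simp]: "Qp_of_rat p r \<in> carrier (Qp p)" for r
    unfolding Qp_of_rat_def by (rule coset_in_carrier_Qp) simp
  have sym: "Qp_abs p (b \<ominus>\<^bsub>Qp p\<^esub> c) = Qp_abs p (c \<ominus>\<^bsub>Qp p\<^esub> b)"
    if bc: "b \<in> carrier (Qp p)" "c \<in> carrier (Qp p)" for b c
  proof -
    have "Qp_abs p (Qp_of_rat p (-1)) = 1"
      using Qp_abs_of_rat[OF p] padic_abs_minus[OF p, of 1] by simp
    moreover have "Qp_of_rat p (-1) = \<ominus>\<^bsub>Qp p\<^esub> \<one>\<^bsub>Qp p\<^esub>"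
      by (simp add: Qp_of_rat_def Qp_one_coset Qp_uminus_coset[OF p])
    moreover have "c \<ominus>\<^bsub>Qp p\<^esub> b = (\<ominus>\<^bsub>Qp p\<^esub> \<one>\<^bsub>Qp p\<^esub>) \<otimes>\<^bsub>Qp p\<^esub> (b \<ominus>\<^bsub>Qp p\<^esub> c)"
      using bc by (simp add: a_minus_def l_minus minus_add r_minus a_comm)
    ultimately show ?thesis using bc by (simp add: Qp_abs_mult[OF p])
  qed
  have tri: "Qp_abs p (b \<ominus>\<^bsub>Qp p\<^esub> d) \<le> max (Qp_abs p (b \<ominus>\<^bsub>Qp p\<^esub> c)) (Qp_abs p (c \<ominus>\<^bsub>Qp p\<^esub> d))"
    if "b \<in> carrier (Qp p)" "c \<in> carrier (Qp p)" "d \<in> carrier (Qp p)" for b c d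
  proof -
    have "b \<ominus>\<^bsub>Qp p\<^esub> d = (b \<ominus>\<^bsub>Qp p\<^esub> c) \<oplus>\<^bsub>Qp p\<^esub> (c \<ominus>\<^bsub>Qp p\<^esub> d)"
      using that by algebra
    thus ?thesis using that by (simp add: Qp_abs_add[OF p])
  qed
  have "\<forall>n. \<exists>r. Qp_abs p (a n \<ominus>\<^bsub>Qp p\<^esub> Qp_of_rat p r) < 1 / real (Suc n)"
    using Qp_dense[OF p a, of "1 / real (Suc n)" n for n] by (metis of_nat_0_less_iff zero_less_Suc zero_less_divide_1_iff)
  then obtain r where r: "\<And>n. Qp_abs p (a n \<ominus>\<^bsub>Qp p\<^esub> Qp_of_rat p (r n)) < 1 / real (Suc n)"
    by metis
  have small: "\<exists>N. \<forall>n\<ge>N. Qp_abs p (a n \<ominus>\<^bsub>Qp p\<^esub> Qp_of_rat p (r n)) < e" if "e > 0" for e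
  proof -
    obtain N where N: "1 / real (Suc N) < e" using \<open>e > 0\<close> nat_approx_posE by blast
    have "Qp_abs p (a n \<ominus>\<^bsub>Qp p\<^esub> Qp_of_rat p (r n)) < e" if "n \<ge> N" for n
    proof -
      have "1 / real (Suc n) \<le> 1 / real (Suc N)" using that by (intro divide_left_mono) auto
      thus ?thesis using r[of n] N by linarith
    qed
    thus ?thesis by blast
  qed
  have rdiff: "padic_abs p (r m - r n) = Qp_abs p (Qp_of_rat p (r m) \<ominus>\<^bsub>Qp p\<^esub> Qp_of_rat p (r n))" for m n
    using Qp_abs_of_rat[OF p, of "r m - r n"] by (simp add: Qp_of_rat_def Qp_minus_coset[OF p])
  have cau: "padic_Cauchy p r"
    unfolding padic_Cauchy_def
  proof (intro allI impI)
    fix e :: real assume e: "e > 0"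
    obtain M where M: "\<And>n. n \<ge> M \<Longrightarrow> Qp_abs p (a n \<ominus>\<^bsub>Qp p\<^esub> Qp_of_rat p (r n)) < e"
      using small[OF e] by blast
    obtain N where N: "\<And>m n. m \<ge> N \<Longrightarrow> n \<ge> N \<Longrightarrow> Qp_abs p (a m \<ominus>\<^bsub>Qp p\<^esub> a n) < e"
      using Cau[OF e] by blast
    have "padic_abs p (r m - r n) < e" if mn: "m \<ge> max M N" "n \<ge> max M N" for m n
    proof -
      have "Qp_abs p (Qp_of_rat p (r m) \<ominus>\<^bsub>Qp p\<^esub> a m) < e"
        using M[of m] mn sym[OF rat a] by simp
      moreover have "Qp_abs p (a m \<ominus>\<^bsub>Qp p\<^esub> Qp_of_rat p (r n)) < e"
        using tri[OF a[of m] a[of n] rat[of "r n"]] M[of n] N[of m n] mn by simp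
      ultimately show ?thesis
        unfolding rdiff using tri[OF rat[of "r m"] a[of m] rat[of "r n"]] by simp
    qed
    thus "\<exists>N. \<forall>m\<ge>N. \<forall>n\<ge>N. padic_abs p (r m - r n) < e" by blast
  qed
  define l where "l = null_seqs p +>\<^bsub>Cauchy_ring p\<^esub> r"
  have l: "l \<in> carrier (Qp p)" unfolding l_def by (rule coset_in_carrier_Qp[OF cau])
  have "(\<lambda>n. Qp_abs p (a n \<ominus>\<^bsub>Qp p\<^esub> l)) \<longlonglongrightarrow> 0"
  proof (rule LIMSEQ_I)
    fix e :: real assume e: "e > 0"
    obtain M where M: "\<And>n. n \<ge> M \<Longrightarrow> Qp_abs p (a n \<ominus>\<^bsub>Qp p\<^esub> Qp_of_rat p (r n)) < e"
      using small[OF e] by blast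
    obtain N where N: "\<And>m n. m \<ge> N \<Longrightarrow> n \<ge> N \<Longrightarrow> padic_abs p (r m - r n) < e / 2"
      using cau e unfolding padic_Cauchy_def by (meson half_gt_zero)
    have "norm (Qp_abs p (a n \<ominus>\<^bsub>Qp p\<^esub> l) - 0) < e" if n: "n \<ge> max M N" for n
    proof -
      have "padic_Cauchy p (\<lambda>m. r n - r m)"
        using padic_Cauchy_add[OF p padic_Cauchy_const[of p "r n"] padic_Cauchy_uminus[OF p cau]] by simp
      from Qp_abs_tendsto[OF p this]
      have "(\<lambda>m. padic_abs p (r n - r m)) \<longlonglongrightarrow> Qp_abs p (Qp_of_rat p (r n) \<ominus>\<^bsub>Qp p\<^esub> l)"
        unfolding l_def Qp_of_rat_def Qp_minus_coset[OF p padic_Cauchy_const cau] .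
      hence "Qp_abs p (Qp_of_rat p (r n) \<ominus>\<^bsub>Qp p\<^esub> l) \<le> e / 2"
        by (rule LIMSEQ_le_const2) (use N n in \<open>auto intro!: exI[of _ N] less_imp_le\<close>)
      hence "Qp_abs p (a n \<ominus>\<^bsub>Qp p\<^esub> l) < e"
        using tri[OF a[of n] rat[of "r n"] l] M[of n] n e by simp
      moreover have "Qp_abs p (a n \<ominus>\<^bsub>Qp p\<^esub> l) \<ge> 0"
        using a l by (intro Qp_abs_nonneg[OF p]) simp
      ultimately show ?thesis by simp
    qed
    thus "\<exists>N. \<forall>n\<ge>N. norm (Qp_abs p (a n \<ominus>\<^bsub>Qp p\<^esub> l) - 0) < e" by blast
  qed
  thus ?thesis using that l by blast
qed


section \<open>Multiplicative approximation\<close>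

definition mult_height :: "int \<Rightarrow> int \<Rightarrow> real" where
  "mult_height x y = sqrt (real_of_int \<bar>x * y\<bar>)"

definition lin_form :: "nat \<Rightarrow> (nat \<Rightarrow> rat) set \<Rightarrow> int \<Rightarrow> int \<Rightarrow> real" where
  "lin_form p \<xi> x y =
     Qp_abs p ((Qp_of_rat p (of_int y) \<otimes>\<^bsub>Qp p\<^esub> \<xi>) \<ominus>\<^bsub>Qp p\<^esub> Qp_of_rat p (of_int x))"

text \<open>
  \<^term>\<open>(x, y)\<close> is coprime, but the competing pairs \<^term>\<open>(x', y')\<close> need not be. As \<open>(p x, p y)\<close>
  has a smaller linear form than \<open>(x, y)\<close>, for some \<open>X \<ge> 1\<close> only non-coprime pairs attain the
  minimum; such \<open>X\<close> contribute no pair.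
\<close>

definition best_approx_at :: "nat \<Rightarrow> (nat \<Rightarrow> rat) set \<Rightarrow> real \<Rightarrow> int \<Rightarrow> int \<Rightarrow> bool" where
  "best_approx_at p \<xi> X x y \<longleftrightarrow>
     x \<noteq> 0 \<and> y \<noteq> 0 \<and> coprime x y \<and> mult_height x y \<le> X \<and>
     (\<forall>x' y'. 0 < mult_height x' y' \<and> mult_height x' y' \<le> X \<longrightarrow> lin_form p \<xi> x y \<le> lin_form p \<xi> x' y')"

text \<open>
  Every term is a best approximation for some \<open>X\<close>, and every \<open>X\<close> that has a best approximation has
  one in the sequence. Best approximations are unique at most up to sign and ties; the
  monotonicity conditions say that exactly one is listed for each value of the linear form, and
  the last condition forces it to be one that appears first as \<open>X\<close> grows. The terms are
  \<^term>\<open>(x k, y k)\<close> for \<^term>\<open>k \<ge> 1\<close>.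
\<close>

definition mult_best_approx_seq ::
    "nat \<Rightarrow> (nat \<Rightarrow> rat) set \<Rightarrow> (nat \<Rightarrow> int) \<Rightarrow> (nat \<Rightarrow> int) \<Rightarrow> bool" where
  "mult_best_approx_seq p \<xi> x y \<longleftrightarrow>
     strict_mono_on {1..} (\<lambda>k. mult_height (x k) (y k)) \<and>
     strict_antimono_on {1..} (\<lambda>k. lin_form p \<xi> (x k) (y k)) \<and>
     (\<forall>k\<ge>1. \<exists>X>0. best_approx_at p \<xi> X (x k) (y k)) \<and>
     (\<forall>X>0. (\<exists>a b. best_approx_at p \<xi> X a b) \<longrightarrow> (\<exists>k\<ge>1. best_approx_at p \<xi> X (x k) (y k)))"

text \<open>The supremum is taken in the extended reals, where it exists unconditionally.\<close>

definition mu_hat_mult :: "nat \<Rightarrow> (nat \<Rightarrow> rat) set \<Rightarrow> ereal" where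
  "mu_hat_mult p \<xi> =
     Sup (ereal ` {\<mu>. \<forall>\<^sub>F X in at_top. \<exists>x y :: int.
            0 < mult_height x y \<and> mult_height x y \<le> X \<and> lin_form p \<xi> x y \<le> X powr (- \<mu>)})"

end

theory Submission
  imports Defs
begin

text \<open>
  Write \<open>Q\<^sub>k\<close>, \<open>L\<^sub>k\<close> for the height and the linear form of the \<open>k\<close>-th best approximation. Consecutive
  best approximations are linearly independent, so their determinant \<open>D\<close> is a nonzero integer with
  \<open>1 \<le> \<bar>D\<bar> \<bar>D\<bar>\<^sub>p \<le> \<bar>D\<bar> L\<^sub>k\<close>, and either assumption gives \<open>\<bar>D\<bar> \<le> 2 C Q\<^sub>k Q\<^sub>k\<^sub>+\<^sub>1\<^sup>2\<close>. A minimiser of the linear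
  form among all pairs of height at most \<open>X < Q\<^sub>k\<^sub>+\<^sub>1\<close> is, up to an integer factor \<open>g\<close>, an earlier
  best approximation; comparing the latter, multiplied by a power of \<open>p\<close>, with the \<open>k\<close>-th one shows that
  the factor \<open>g\<close> costs little: \<open>L\<^sub>k \<le> (p X / Q\<^sub>k) X\<^sup>-\<^sup>\<mu>\<close>. For \<open>X\<close> comparable to \<open>Q\<^sub>k\<^sub>+\<^sub>1\<close> this yields
  \<open>1 \<le> 8 C p X\<^sup>3\<^sup>-\<^sup>\<mu>\<close>.
\<close>

section \<open>The \<open>p\<close>-adic absolute value on integers\<close>

lemma padic_abs_of_int_le_1:
  assumes "prime p"
  shows "padic_abs p (of_int a) \<le> 1"
proof (cases "a = 0")
  case False
  have "1 \<le> real p ^ multiplicity (int p) a"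
    using prime_gt_0_nat[OF assms] by (intro one_le_power) simp
  thus ?thesis
    unfolding padic_abs_of_int[OF assms False] using prime_gt_0_nat[OF assms] by simp
qed simp

text \<open>The exact power of \<open>p\<close> in a nonzero integer divides it, hence does not
  exceed its ordinary size. This inequality converts \<open>p\<close>-adic smallness into
  archimedean size.\<close>

lemma product_formula_ge_1:
  assumes "prime p" "a \<noteq> 0"
  shows "1 \<le> real_of_int \<bar>a\<bar> * padic_abs p (of_int a)"
proof -
  have "int p ^ multiplicity (int p) a dvd \<bar>a\<bar>"
    by (simp add: multiplicity_dvd)
  hence "int p ^ multiplicity (int p) a \<le> \<bar>a\<bar>"
    using assms(2) by (intro zdvd_imp_le) auto
  hence "real p ^ multiplicity (int p) a \<le> real_of_int \<bar>a\<bar>"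
    by (metis of_int_le_iff of_int_of_nat_eq of_int_power)
  thus ?thesis
    unfolding padic_abs_of_int[OF assms] using prime_gt_0_nat[OF assms(1)] by simp
qed

lemma padic_abs_prime_power:
  assumes "prime p"
  shows "padic_abs p (of_int (int p ^ n)) = 1 / real p ^ n"
proof (induction n)
  case (Suc n)
  thus ?case using padic_abs_prime[OF assms]
    by (simp add: padic_abs_mult[OF assms])
qed simp

section \<open>The linear form as a limit of rational values\<close>

text \<open>One Cauchy sequence representing \<open>\<xi>\<close> serves all pairs simultaneously,
  so relations between several linear forms can be checked over the rationals and passed to the
  limit.\<close>

lemma lin_form_limit:
  assumes p: "prime p" and "\<xi> \<in> carrier (Qp p)"
  obtains s where "\<And>x y. (\<lambda>n. padic_abs p (of_int y * s n - of_int x)) \<longlonglongrightarrow> lin_form p \<xi> x y"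
proof -
  obtain s where s: "padic_Cauchy p s" "\<xi> = null_seqs p +>\<^bsub>Cauchy_ring p\<^esub> s"
    using assms carrier_QpE by metis
  have "(\<lambda>n. padic_abs p (of_int y * s n - of_int x)) \<longlonglongrightarrow> lin_form p \<xi> x y" for x y
  proof -
    have c: "padic_Cauchy p (\<lambda>n. of_int y * s n)"
      by (rule padic_Cauchy_mult[OF p padic_Cauchy_const s(1)])
    have "padic_Cauchy p (\<lambda>n. of_int y * s n - of_int x)"
      using padic_Cauchy_add[OF p c padic_Cauchy_uminus[OF p padic_Cauchy_const, of "of_int x"]]
      by simp
    from Qp_abs_tendsto[OF p this] show ?thesis
      unfolding lin_form_def s(2) Qp_of_rat_def
      by (simp only: Qp_mult_coset[OF p padic_Cauchy_const s(1)]
          Qp_minus_coset[OF p c padic_Cauchy_const])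
  qed
  thus ?thesis using that by blast
qed

lemma lin_form_nonneg:
  assumes "prime p" "\<xi> \<in> carrier (Qp p)"
  shows "lin_form p \<xi> x y \<ge> 0"
proof -
  obtain s where "\<And>x y. (\<lambda>n. padic_abs p (of_int y * s n - of_int x)) \<longlonglongrightarrow> lin_form p \<xi> x y"
    using lin_form_limit[OF assms] by blast
  from tendsto_lowerbound[OF this[where x = x and y = y]] show ?thesis
    by (simp add: padic_abs_nonneg)
qed

lemma lin_form_scale:
  assumes p: "prime p" and "\<xi> \<in> carrier (Qp p)"
  shows "lin_form p \<xi> (g * x) (g * y) = padic_abs p (of_int g) * lin_form p \<xi> x y"
proof -
  obtain s where s: "\<And>x y. (\<lambda>n. padic_abs p (of_int y * s n - of_int x)) \<longlonglongrightarrow> lin_form p \<xi> x y"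
    using lin_form_limit[OF assms] by blast
  have "of_int (g * y) * s n - of_int (g * x) = of_int g * (of_int y * s n - of_int x)" for n
    by (simp add: algebra_simps)
  hence eq: "padic_abs p (of_int (g * y) * s n - of_int (g * x)) =
      padic_abs p (of_int g) * padic_abs p (of_int y * s n - of_int x)" for n
    by (simp only: padic_abs_mult[OF p])
  show ?thesis
    using LIMSEQ_unique[OF s[of "g * y" "g * x", unfolded eq] tendsto_mult[OF tendsto_const s]] .
qed

text \<open>Eliminating \<open>\<xi>\<close> writes the determinant as a combination of the two
  forms with coefficients \<open>y\<close> and \<open>- y'\<close>; integers have absolute value at
  most 1, and the ultrametric inequality does the rest.\<close>

lemma padic_abs_det_le:
  assumes p: "prime p" and "\<xi> \<in> carrier (Qp p)"
  shows "padic_abs p (of_int (x * y' - x' * y)) \<le> max (lin_form p \<xi> x y) (lin_form p \<xi> x' y')"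
proof -
  obtain s where s: "\<And>x y. (\<lambda>n. padic_abs p (of_int y * s n - of_int x)) \<longlonglongrightarrow> lin_form p \<xi> x y"
    using lin_form_limit[OF assms] by blast
  have le: "padic_abs p (of_int (x * y' - x' * y)) \<le>
      max (padic_abs p (of_int y * s n - of_int x)) (padic_abs p (of_int y' * s n - of_int x'))" for n
  proof -
    let ?u = "of_int y * s n - of_int x" and ?v = "of_int y' * s n - of_int x'"
    have small: "padic_abs p (of_int a * r) \<le> padic_abs p r" for a r
      using mult_right_mono[OF padic_abs_of_int_le_1[OF p, of a] padic_abs_nonneg[of p r]]
      by (simp add: padic_abs_mult[OF p])
    have "of_int (x * y' - x' * y) = of_int y * ?v - of_int y' * ?u"
      by (simp add: algebra_simps)
    hence "padic_abs p (of_int (x * y' - x' * y)) \<le>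
        max (padic_abs p (of_int y * ?v)) (padic_abs p (of_int y' * ?u))"
      using padic_abs_diff_le[OF p] by metis
    thus ?thesis using small[of y ?v] small[of y' ?u] by linarith
  qed
  show ?thesis
    by (rule LIMSEQ_le_const[OF tendsto_max[OF s s]]) (use le in blast)
qed

section \<open>The multiplicative height\<close>

lemma mult_height_sq: "mult_height x y ^ 2 = real_of_int \<bar>x\<bar> * real_of_int \<bar>y\<bar>"
  by (simp add: mult_height_def abs_mult)

lemma mult_height_nonneg: "mult_height x y \<ge> 0"
  by (simp add: mult_height_def)

lemma mult_height_pos_iff: "mult_height x y > 0 \<longleftrightarrow> x \<noteq> 0 \<and> y \<noteq> 0"
  by (auto simp: mult_height_def)

lemma mult_height_ge_1:
  assumes "x \<noteq> 0" "y \<noteq> 0"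
  shows "mult_height x y \<ge> 1"
proof -
  have "\<bar>x * y\<bar> \<ge> 1" using assms by (simp add: int_one_le_iff_zero_less)
  hence "real_of_int \<bar>x * y\<bar> \<ge> 1" by linarith
  thus ?thesis unfolding mult_height_def by simp
qed

lemma mult_height_scale: "mult_height (g * x) (g * y) = real_of_int \<bar>g\<bar> * mult_height x y"
proof -
  have "real_of_int \<bar>(g * x) * (g * y)\<bar> = (real_of_int \<bar>g\<bar>)\<^sup>2 * real_of_int \<bar>x * y\<bar>"
    by (simp add: abs_mult power2_eq_square)
  thus ?thesis unfolding mult_height_def by (simp add: real_sqrt_mult)
qed

text \<open>Positive height excludes zero coordinates, so each coordinate is bounded by the product.
  Finiteness guarantees that minimisers of the linear form exist.\<close>

lemma finite_mult_height_le: "finite {(x, y). 0 < mult_height x y \<and> mult_height x y \<le> X}"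
proof (rule finite_subset)
  let ?N = "\<lceil>X\<^sup>2\<rceil>"
  show "{(x, y). 0 < mult_height x y \<and> mult_height x y \<le> X} \<subseteq> {-?N..?N} \<times> {-?N..?N}"
  proof safe
    fix x y assume h: "0 < mult_height x y" "mult_height x y \<le> X"
    have xy: "\<bar>x\<bar> \<ge> 1" "\<bar>y\<bar> \<ge> 1" using h(1) by (auto simp: mult_height_pos_iff)
    have "mult_height x y ^ 2 \<le> X\<^sup>2"
      using h by (intro power_mono) auto
    hence "real_of_int (\<bar>x\<bar> * \<bar>y\<bar>) \<le> X\<^sup>2" by (simp add: mult_height_sq)
    hence "\<bar>x\<bar> * \<bar>y\<bar> \<le> ?N" by linarith
    moreover have "\<bar>x\<bar> * 1 \<le> \<bar>x\<bar> * \<bar>y\<bar>" "1 * \<bar>y\<bar> \<le> \<bar>x\<bar> * \<bar>y\<bar>"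
      using xy by (intro mult_mono; simp)+
    ultimately have "\<bar>x\<bar> \<le> ?N" "\<bar>y\<bar> \<le> ?N" by linarith+
    thus "x \<in> {-?N..?N}" "y \<in> {-?N..?N}" by auto
  qed
qed simp

section \<open>Best approximations versus minimisers that are not coprime\<close>

text \<open>Dividing by the gcd \<open>g\<close> preserves minimality: a competitor of the reduced
  pair, multiplied by \<open>g\<close>, competes with \<open>(a, b)\<close>, and both forms change
  by the same positive factor.\<close>

lemma primitive_minimiser_is_best:
  assumes p: "prime p" and \<xi>: "\<xi> \<in> carrier (Qp p)"
    and ab: "0 < mult_height a b"
    and min: "\<And>u v. 0 < mult_height u v \<Longrightarrow> mult_height u v \<le> mult_height a b \<Longrightarrow>
                lin_form p \<xi> a b \<le> lin_form p \<xi> u v"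
  obtains g a' b' where "g > 0" "a = g * a'" "b = g * b'"
    "best_approx_at p \<xi> (mult_height a' b') a' b'"
proof -
  have ab0: "a \<noteq> 0" "b \<noteq> 0" using ab by (auto simp: mult_height_pos_iff)
  define g where "g = gcd a b"
  have g: "g > 0" using ab0 by (simp add: g_def)
  obtain a' b' where *: "a = g * a'" "b = g * b'" "coprime a' b'"
    using gcd_coprime_exists[of a b] ab0 unfolding g_def by (metis gcd_eq_0_iff mult.commute)
  have "lin_form p \<xi> a' b' \<le> lin_form p \<xi> u v"
    if uv: "0 < mult_height u v" "mult_height u v \<le> mult_height a' b'" for u v
  proof -
    have "lin_form p \<xi> a b \<le> lin_form p \<xi> (g * u) (g * v)"
      using uv g by (intro min) (simp_all add: * mult_height_scale)
    moreover have "padic_abs p (of_int g) > 0"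
      using padic_abs_nonneg[of p "of_int g"] padic_abs_eq_0_iff[OF p, of "of_int g"] g by simp
    ultimately show ?thesis by (simp add: * lin_form_scale[OF p \<xi>])
  qed
  thus ?thesis using that[OF g *(1,2)] ab0 * by (simp add: best_approx_at_def)
qed

lemma exists_power_between:
  assumes "p > (1::real)" "r \<ge> 1"
  obtains n where "p ^ n \<le> r" "r < p ^ Suc n"
proof -
  define n where "n = (LEAST m. r < p ^ m)"
  have ex: "\<exists>m. r < p ^ m" using assms real_arch_pow by blast
  have n: "r < p ^ n" unfolding n_def using ex by (rule LeastI_ex)
  have "n \<noteq> 0" using n assms by (intro notI) simp
  then obtain m where m: "n = Suc m" by (cases n) auto
  have "\<not> r < p ^ m" using not_less_Least[of m "\<lambda>m. r < p ^ m"] m n_def by simp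
  thus ?thesis using that[of m] n m by simp
qed

text \<open>Since non-coprime pairs compete too, the \<open>k\<close>-th form need not be minimal
  all the way up to the next height. The estimate bounds the loss: a factor \<open>p\<close> for
  rounding to a power of \<open>p\<close>, and the ratio of \<open>X\<close> to the
  \<open>k\<close>-th height.\<close>

lemma best_approx_seq_lower_bound:
  assumes p: "prime p" and \<xi>: "\<xi> \<in> carrier (Qp p)"
    and seq: "mult_best_approx_seq p \<xi> x y" and k: "k \<ge> 1"
    and X: "X < mult_height (x (k + 1)) (y (k + 1))"
    and uv: "0 < mult_height u v" "mult_height u v \<le> X"
  shows "mult_height (x k) (y k) * lin_form p \<xi> (x k) (y k) \<le> real p * X * lin_form p \<xi> u v"
proof -
  define L where "L = (\<lambda>u v. lin_form p \<xi> u v)"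
  define Q where "Q = (\<lambda>k. mult_height (x k) (y k))"
  have L0: "L u v \<ge> 0" for u v unfolding L_def by (rule lin_form_nonneg[OF p \<xi>])
  let ?S = "{(u, v). 0 < mult_height u v \<and> mult_height u v \<le> X}"
  have fin: "finite ?S" and ne: "?S \<noteq> {}" using finite_mult_height_le uv by auto
  obtain a b where ab: "0 < mult_height a b" "mult_height a b \<le> X"
    and min: "\<And>u v. 0 < mult_height u v \<Longrightarrow> mult_height u v \<le> X \<Longrightarrow> L a b \<le> L u v"
    using ex_is_arg_min_if_finite[OF fin ne, of "\<lambda>(u, v). L u v"]
    by (fastforce simp: is_arg_min_linorder)
  obtain g a' b' where g: "g > 0" "a = g * a'" "b = g * b'"
    and best: "best_approx_at p \<xi> (mult_height a' b') a' b'"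
    using primitive_minimiser_is_best[OF p \<xi> ab(1)] min ab(2) unfolding L_def
    by (metis order_trans)
  have h': "mult_height a' b' > 0" using best by (simp add: best_approx_at_def mult_height_pos_iff)
  \<comment> \<open>The listed term may differ from \<open>(a', b')\<close>, but neither its height
    nor its form is larger.\<close>
  obtain j where j: "j \<ge> 1" "best_approx_at p \<xi> (mult_height a' b') (x j) (y j)"
    using seq best h' unfolding mult_best_approx_seq_def by blast
  have Qj: "Q j \<le> mult_height a' b'" "Q j \<ge> 1"
    using j(2) by (auto simp: best_approx_at_def Q_def mult_height_ge_1)
  have Lj: "L (x j) (y j) \<le> L a' b'"
    using j(2) h' by (simp add: best_approx_at_def L_def)
  have hab: "mult_height a b = real_of_int g * mult_height a' b'"
    using g by (simp add: mult_height_scale)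
  have "1 * mult_height a' b' \<le> real_of_int g * mult_height a' b'"
    using g h' by (intro mult_right_mono) auto
  hence "Q j < Q (k + 1)" using Qj X ab hab unfolding Q_def by linarith
  moreover have sm: "strict_mono_on {1..} Q"
    using seq by (simp add: mult_best_approx_seq_def Q_def)
  ultimately have "j < k + 1"
    using j(1) k by (auto simp: strict_mono_on_less)
  hence Qjk: "Q j \<le> Q k"
    using sm j(1) k by (auto simp: strict_mono_on_less_eq)
  have p1: "real p > 1" using prime_gt_1_nat[OF p] by simp
  \<comment> \<open>The largest power of \<open>p\<close> for which the scaled \<open>j\<close>-th
    pair still competes with the \<open>k\<close>-th one.\<close>
  obtain n where n: "real p ^ n \<le> Q k / Q j" "Q k / Q j < real p ^ Suc n"
    using exists_power_between[OF p1, of "Q k / Q j"] Qjk Qj(2) by auto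
  obtain Y where Y: "best_approx_at p \<xi> Y (x k) (y k)"
    using seq k by (auto simp: mult_best_approx_seq_def)
  have "L (x k) (y k) \<le> L (int p ^ n * x j) (int p ^ n * y j)"
  proof -
    have h: "mult_height (int p ^ n * x j) (int p ^ n * y j) = real p ^ n * Q j"
      by (simp add: mult_height_scale Q_def)
    have "real p ^ n * Q j \<le> Q k" using n(1) Qj(2) by (simp add: field_simps)
    also have "\<dots> \<le> Y" using Y by (simp add: best_approx_at_def Q_def)
    finally show ?thesis
      using Y h p1 Qj(2) unfolding best_approx_at_def L_def by simp
  qed
  also have "\<dots> = L (x j) (y j) / real p ^ n"
    by (simp only: L_def lin_form_scale[OF p \<xi>] padic_abs_prime_power[OF p]) simp
  also have "\<dots> \<le> L a' b' / real p ^ n"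
    using Lj p1 by (intro divide_right_mono) auto
  finally have 1: "real p ^ n * L (x k) (y k) \<le> L a' b'"
    using p1 by (simp add: field_simps)
  \<comment> \<open>Removing the factor \<open>g\<close> divides the form by the absolute value of
    \<open>g\<close>, which is at least \<open>1 / g\<close>.\<close>
  have 2: "L a' b' \<le> real_of_int g * L a b"
  proof -
    have "1 * L a' b' \<le> (real_of_int \<bar>g\<bar> * padic_abs p (of_int g)) * L a' b'"
      using product_formula_ge_1[OF p, of g] g L0 by (intro mult_right_mono) auto
    thus ?thesis using g by (simp add: L_def lin_form_scale[OF p \<xi>])
  qed
  have "Q k * L (x k) (y k) \<le> (real p ^ Suc n * Q j) * L (x k) (y k)"
    using n(2) Qj(2) L0 by (intro mult_right_mono) (auto simp: field_simps)
  also have "\<dots> = real p * Q j * (real p ^ n * L (x k) (y k))" by simp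
  also have "\<dots> \<le> real p * Q j * (real_of_int g * L a b)"
    using 1 2 Qj(2) by (intro mult_left_mono) auto
  also have "\<dots> = real p * L a b * (real_of_int g * Q j)" by simp
  \<comment> \<open>The loss \<open>g\<close> is paid for by height: \<open>g * Q j\<close> is at
    most the height of \<open>(a, b)\<close>.\<close>
  also have "\<dots> \<le> real p * L a b * X"
    using Qj(1) g(1) hab ab(2) L0
    by (intro mult_left_mono order_trans[OF mult_left_mono[OF Qj(1)], of "real_of_int g"]) auto
  also have "\<dots> \<le> real p * L u v * X"
    using min[OF uv] uv by (intro mult_right_mono mult_left_mono) auto
  finally show ?thesis by (simp add: L_def Q_def mult_ac)
qed

text \<open>Squared heights are strictly increasing positive integers. Thus large indices force
  large heights.\<close>

lemma best_approx_seq_height_ge: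
  assumes "mult_best_approx_seq p \<xi> x y" "k \<ge> 1"
  shows "mult_height (x k) (y k) \<ge> sqrt (real k)"
  using assms(2)
proof (induction k rule: dec_induct)
  case base
  show ?case using assms(1) by (auto simp: mult_best_approx_seq_def best_approx_at_def intro!: mult_height_ge_1)
next
  case (step k)
  have "mult_height (x k) (y k) < mult_height (x (Suc k)) (y (Suc k))"
    using assms(1) step by (auto simp: mult_best_approx_seq_def strict_mono_on_def)
  hence "\<bar>x k * y k\<bar> < \<bar>x (Suc k) * y (Suc k)\<bar>"
    unfolding mult_height_def real_sqrt_less_iff by linarith
  moreover have "int k \<le> \<bar>x k * y k\<bar>"
    using step unfolding mult_height_def real_sqrt_le_iff by linarith
  ultimately have "real (Suc k) \<le> real_of_int \<bar>x (Suc k) * y (Suc k)\<bar>" by linarith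
  thus ?case unfolding mult_height_def real_sqrt_le_iff .
qed

section \<open>Determinants of consecutive best approximations\<close>

text \<open>A zero determinant would make two coprime pairs proportional, hence equal up to signs
  and of equal height. For a nonzero one, \<open>product_formula_ge_1\<close> applies, and the
  larger of the two forms is the \<open>k\<close>-th.\<close>

lemma consecutive_det_ge:
  assumes p: "prime p" and \<xi>: "\<xi> \<in> carrier (Qp p)"
    and seq: "mult_best_approx_seq p \<xi> x y" and k: "k \<ge> 1"
  shows "1 \<le> real_of_int \<bar>x k * y (k + 1) - x (k + 1) * y k\<bar> * lin_form p \<xi> (x k) (y k)"
proof -
  let ?D = "x k * y (k + 1) - x (k + 1) * y k"
  have cop: "coprime (x i) (y i)" if "i \<ge> 1" for i
    using seq that by (auto simp: mult_best_approx_seq_def best_approx_at_def)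
  have less: "mult_height (x k) (y k) < mult_height (x (k + 1)) (y (k + 1))"
    using seq k by (auto simp: mult_best_approx_seq_def strict_mono_on_def)
  have "?D \<noteq> 0"
  proof
    assume "?D = 0"
    hence "\<bar>x k\<bar> * \<bar>y (k + 1)\<bar> = \<bar>x (k + 1)\<bar> * \<bar>y k\<bar>"
      by (simp add: abs_mult[symmetric])
    hence "\<bar>x k\<bar> = \<bar>x (k + 1)\<bar>" "\<bar>y (k + 1)\<bar> = \<bar>y k\<bar>"
      using coprime_crossproduct_int[of "x k" "y k" "x (k + 1)" "y (k + 1)"] cop[of k] cop[of "k + 1"] k
      by simp_all
    hence "mult_height (x k) (y k) = mult_height (x (k + 1)) (y (k + 1))"
      unfolding mult_height_def by (simp only: abs_mult)
    with less show False by simp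
  qed
  from product_formula_ge_1[OF p this]
  have "1 \<le> real_of_int \<bar>?D\<bar> * padic_abs p (of_int ?D)" .
  also have "lin_form p \<xi> (x (k + 1)) (y (k + 1)) < lin_form p \<xi> (x k) (y k)"
    using seq k by (auto simp: mult_best_approx_seq_def monotone_on_def)
  hence "padic_abs p (of_int ?D) \<le> lin_form p \<xi> (x k) (y k)"
    using padic_abs_det_le[OF p \<xi>, of "x k" "y (k + 1)" "x (k + 1)" "y k"] by simp
  hence "real_of_int \<bar>?D\<bar> * padic_abs p (of_int ?D) \<le> real_of_int \<bar>?D\<bar> * lin_form p \<xi> (x k) (y k)"
    by (intro mult_left_mono) auto
  finally show ?thesis .
qed

text \<open>The ratio condition makes the second coordinate at most the height divided by
  \<open>sqrt c\<close>; the first is trivially at most the squared height. Each product in the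
  determinant pairs one of each kind.\<close>

lemma det_le_of_ratio:
  fixes a b a' b' :: int
  assumes nz: "a \<noteq> 0" "b \<noteq> 0" "a' \<noteq> 0" "b' \<noteq> 0" and c: "c > 0"
    and r: "c * real_of_int \<bar>b\<bar> \<le> real_of_int \<bar>a\<bar>" "c * real_of_int \<bar>b'\<bar> \<le> real_of_int \<bar>a'\<bar>"
    and le: "mult_height a b \<le> mult_height a' b'"
  shows "real_of_int \<bar>a * b' - a' * b\<bar> \<le> 2 * (1 / sqrt c) * mult_height a b * mult_height a' b' ^ 2"
proof -
  let ?q = "mult_height a b" and ?q' = "mult_height a' b'" and ?C = "1 / sqrt c"
  have long: "real_of_int \<bar>u\<bar> \<le> mult_height u v ^ 2" if "v \<noteq> 0" for u v
    using mult_left_mono[of 1 "real_of_int \<bar>v\<bar>" "real_of_int \<bar>u\<bar>"] that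
    by (simp add: mult_height_sq)
  have short: "real_of_int \<bar>v\<bar> \<le> ?C * mult_height u v"
    if "c * real_of_int \<bar>v\<bar> \<le> real_of_int \<bar>u\<bar>" for u v
  proof -
    have "(sqrt c * real_of_int \<bar>v\<bar>)\<^sup>2 = (c * real_of_int \<bar>v\<bar>) * real_of_int \<bar>v\<bar>"
      using c by (simp add: power_mult_distrib power2_eq_square)
    also have "\<dots> \<le> mult_height u v ^ 2"
      unfolding mult_height_sq by (rule mult_right_mono[OF that]) simp
    finally have "sqrt c * real_of_int \<bar>v\<bar> \<le> mult_height u v"
      by (rule power2_le_imp_le) (rule mult_height_nonneg)
    thus ?thesis using c by (simp add: field_simps)
  qed
  have C: "?C > 0" using c by simp
  have "real_of_int \<bar>a * b' - a' * b\<bar> \<le>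
      real_of_int \<bar>a\<bar> * real_of_int \<bar>b'\<bar> + real_of_int \<bar>a'\<bar> * real_of_int \<bar>b\<bar>"
    using abs_triangle_ineq4[of "real_of_int (a * b')" "real_of_int (a' * b)"] by (simp add: abs_mult)
  also have "\<dots> \<le> ?q\<^sup>2 * (?C * ?q') + ?q'\<^sup>2 * (?C * ?q)"
    using long nz short r by (intro add_mono mult_mono) auto
  also have "?q\<^sup>2 * (?C * ?q') = (?C * ?q * ?q') * ?q" by (simp add: power2_eq_square)
  also have "\<dots> \<le> (?C * ?q * ?q') * ?q'"
    using C le by (intro mult_left_mono) (auto simp: mult_height_nonneg)
  also have "(?C * ?q * ?q') * ?q' + ?q'\<^sup>2 * (?C * ?q) = 2 * ?C * ?q * ?q'\<^sup>2"
    by (simp add: power2_eq_square)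
  finally show ?thesis by simp
qed

section \<open>Bounding the uniform exponent\<close>

theorem theorem3p3:
  fixes p :: nat and \<xi> :: "(nat \<Rightarrow> rat) set" and x y :: "nat \<Rightarrow> int"
  assumes "prime p"
    and "\<xi> \<in> carrier (Qp p)"
    and "\<xi> \<notin> range (Qp_of_rat p)"
    and "mult_best_approx_seq p \<xi> x y"
    and "(\<exists>c>0. \<forall>N. \<exists>k\<ge>max 1 N.
            real_of_int \<bar>x k\<bar> \<ge> c * real_of_int \<bar>y k\<bar> \<and>
            real_of_int \<bar>x (k + 1)\<bar> \<ge> c * real_of_int \<bar>y (k + 1)\<bar>) \<or>
         (\<exists>c>0. \<forall>N. \<exists>k\<ge>max 1 N.
            real_of_int \<bar>x k\<bar> \<le> c * real_of_int \<bar>y k\<bar> \<and>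
            real_of_int \<bar>x (k + 1)\<bar> \<le> c * real_of_int \<bar>y (k + 1)\<bar>)"
  shows "mu_hat_mult p \<xi> \<le> 3"
proof -
  note p = assms(1) and \<xi> = assms(2) and seq = assms(4)
  define L where "L = (\<lambda>u v. lin_form p \<xi> u v)"
  define Q where "Q = (\<lambda>k. mult_height (x k) (y k))"
  have nz: "x k \<noteq> 0" "y k \<noteq> 0" if "k \<ge> 1" for k
    using seq that by (auto simp: mult_best_approx_seq_def best_approx_at_def)
  have Qless: "Q k < Q (k + 1)" if "k \<ge> 1" for k
    using seq that by (auto simp: mult_best_approx_seq_def strict_mono_on_def Q_def)
  have Q1: "Q k \<ge> 1" if "k \<ge> 1" for k
    unfolding Q_def by (rule mult_height_ge_1[OF nz[OF that]])
  \<comment> \<open>Both alternatives enter the argument only through this determinant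
    bound.\<close>
  have det: "\<exists>C. \<forall>N. \<exists>k\<ge>max 1 N.
      real_of_int \<bar>x k * y (k + 1) - x (k + 1) * y k\<bar> \<le> 2 * C * Q k * Q (k + 1) ^ 2"
    using assms(5)
  proof
    assume "\<exists>c>0. \<forall>N. \<exists>k\<ge>max 1 N. real_of_int \<bar>x k\<bar> \<ge> c * real_of_int \<bar>y k\<bar> \<and>
            real_of_int \<bar>x (k + 1)\<bar> \<ge> c * real_of_int \<bar>y (k + 1)\<bar>"
    then obtain c where c: "c > 0" "\<forall>N. \<exists>k\<ge>max 1 N. real_of_int \<bar>x k\<bar> \<ge> c * real_of_int \<bar>y k\<bar> \<and>
            real_of_int \<bar>x (k + 1)\<bar> \<ge> c * real_of_int \<bar>y (k + 1)\<bar>" by blast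
    show ?thesis
    proof (intro exI[of _ "1 / sqrt c"] allI)
      fix N
      obtain k where k: "k \<ge> max 1 N" "c * real_of_int \<bar>y k\<bar> \<le> real_of_int \<bar>x k\<bar>"
        "c * real_of_int \<bar>y (k + 1)\<bar> \<le> real_of_int \<bar>x (k + 1)\<bar>" using c(2) by blast
      have "real_of_int \<bar>x k * y (k + 1) - x (k + 1) * y k\<bar> \<le> 2 * (1 / sqrt c) * Q k * Q (k + 1) ^ 2"
        using k nz[of k] nz[of "k + 1"] Qless[of k] c(1) unfolding Q_def
        by (intro det_le_of_ratio) auto
      thus "\<exists>k\<ge>max 1 N. real_of_int \<bar>x k * y (k + 1) - x (k + 1) * y k\<bar>
              \<le> 2 * (1 / sqrt c) * Q k * Q (k + 1) ^ 2" using k(1) by blast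
    qed
  next
    assume "\<exists>c>0. \<forall>N. \<exists>k\<ge>max 1 N. real_of_int \<bar>x k\<bar> \<le> c * real_of_int \<bar>y k\<bar> \<and>
            real_of_int \<bar>x (k + 1)\<bar> \<le> c * real_of_int \<bar>y (k + 1)\<bar>"
    then obtain c where c: "c > 0" "\<forall>N. \<exists>k\<ge>max 1 N. real_of_int \<bar>x k\<bar> \<le> c * real_of_int \<bar>y k\<bar> \<and>
            real_of_int \<bar>x (k + 1)\<bar> \<le> c * real_of_int \<bar>y (k + 1)\<bar>" by blast
    show ?thesis
    \<comment> \<open>Swapping the coordinates reduces this case to the previous one: the height is
      symmetric and the ratio constant becomes \<open>1 / c\<close>.\<close>
    proof (intro exI[of _ "1 / sqrt (1 / c)"] allI)
      fix N
      obtain k where k: "k \<ge> max 1 N" "1 / c * real_of_int \<bar>x k\<bar> \<le> real_of_int \<bar>y k\<bar>"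
        "1 / c * real_of_int \<bar>x (k + 1)\<bar> \<le> real_of_int \<bar>y (k + 1)\<bar>"
      proof -
        obtain k where "k \<ge> max 1 N" "real_of_int \<bar>x k\<bar> \<le> c * real_of_int \<bar>y k\<bar>"
          "real_of_int \<bar>x (k + 1)\<bar> \<le> c * real_of_int \<bar>y (k + 1)\<bar>" using c(2) by blast
        thus ?thesis using that[of k] c(1) by (simp add: field_simps)
      qed
      have sym: "Q i = mult_height (y i) (x i)" for i
        by (simp add: Q_def mult_height_def mult.commute)
      have "real_of_int \<bar>y k * x (k + 1) - y (k + 1) * x k\<bar> \<le> 2 * (1 / sqrt (1 / c)) * Q k * Q (k + 1) ^ 2"
        using k nz[of k] nz[of "k + 1"] Qless[of k] c(1) unfolding sym
        by (intro det_le_of_ratio) auto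
      moreover have "\<bar>y k * x (k + 1) - y (k + 1) * x k\<bar> = \<bar>x k * y (k + 1) - x (k + 1) * y k\<bar>"
        by (simp add: abs_minus_commute mult.commute)
      ultimately show "\<exists>k\<ge>max 1 N. real_of_int \<bar>x k * y (k + 1) - x (k + 1) * y k\<bar>
              \<le> 2 * (1 / sqrt (1 / c)) * Q k * Q (k + 1) ^ 2" using k(1) by metis
    qed
  qed
  then obtain C where C: "\<And>N. \<exists>k\<ge>max 1 N.
      real_of_int \<bar>x k * y (k + 1) - x (k + 1) * y k\<bar> \<le> 2 * C * Q k * Q (k + 1) ^ 2" by blast
  have "\<mu> \<le> 3"
    if \<mu>: "\<forall>\<^sub>F X in at_top. \<exists>u v. 0 < mult_height u v \<and> mult_height u v \<le> X \<and> L u v \<le> X powr (- \<mu>)"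
    for \<mu> :: real
  proof (rule ccontr)
    assume "\<not> \<mu> \<le> 3"
    \<comment> \<open>The constant anticipates the final estimate: \<open>2 * C\<close> from the
      determinant, 4 from squaring \<open>2 * X\<close>, and \<open>p\<close> from the lower bound
      lemma.\<close>
    hence "((\<lambda>X::real. 8 * C * real p * X powr (3 - \<mu>)) \<longlongrightarrow> 8 * C * real p * 0) at_top"
      by (intro tendsto_intros tendsto_neg_powr filterlim_ident) auto
    hence "\<forall>\<^sub>F X in at_top. 8 * C * real p * X powr (3 - \<mu>) < 1"
      by (intro order_tendstoD) auto
    with \<mu> have "\<forall>\<^sub>F X in at_top. 8 * C * real p * X powr (3 - \<mu>) < 1 \<and>
        (\<exists>u v. 0 < mult_height u v \<and> mult_height u v \<le> X \<and> L u v \<le> X powr (- \<mu>))"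
      by eventually_elim blast
    then obtain X0 where X0: "\<And>X. X \<ge> X0 \<Longrightarrow> 8 * C * real p * X powr (3 - \<mu>) < 1"
      "\<And>X. X \<ge> X0 \<Longrightarrow> \<exists>u v. 0 < mult_height u v \<and> mult_height u v \<le> X \<and> L u v \<le> X powr (- \<mu>)"
      unfolding eventually_at_top_linorder by blast
    \<comment> \<open>This threshold gives \<open>sqrt (real k)\<close> at least \<open>X0\<close>,
      so that \<open>Q k\<close> lies in the range where \<open>X0\<close> applies.\<close>
    obtain k where k: "k \<ge> max 1 (nat \<lceil>X0\<^sup>2\<rceil>)"
      and D: "real_of_int \<bar>x k * y (k + 1) - x (k + 1) * y k\<bar> \<le> 2 * C * Q k * Q (k + 1) ^ 2"
      using C by blast
    have k1: "k \<ge> 1" using k by simp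
    have "X0\<^sup>2 \<le> real k" using k by linarith
    hence "\<bar>X0\<bar> \<le> sqrt (real k)" by (metis real_sqrt_abs real_sqrt_le_iff)
    also have "\<dots> \<le> Q k" unfolding Q_def by (rule best_approx_seq_height_ge[OF seq k1])
    finally have X0Q: "X0 \<le> Q k" by simp
    \<comment> \<open>The midpoint stays strictly below \<open>Q (k + 1)\<close>, as the lower bound
      lemma demands, yet is at least half of it.\<close>
    define X where "X = (Q k + Q (k + 1)) / 2"
    have X: "Q k \<le> X" "X < Q (k + 1)" "Q (k + 1) \<le> 2 * X" "X \<ge> X0" "X > 0"
      using Qless[OF k1] Q1[OF k1] X0Q by (auto simp: X_def)
    obtain u v where uv: "0 < mult_height u v" "mult_height u v \<le> X" "L u v \<le> X powr (- \<mu>)"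
      using X0(2)[OF X(4)] by blast
    let ?D = "real_of_int \<bar>x k * y (k + 1) - x (k + 1) * y k\<bar>"
    have D1: "1 \<le> ?D * L (x k) (y k)"
      unfolding L_def by (rule consecutive_det_ge[OF p \<xi> seq k1])
    have L0: "L (x k) (y k) \<ge> 0" unfolding L_def by (rule lin_form_nonneg[OF p \<xi>])
    \<comment> \<open>The sign of \<open>C\<close> was not recorded with \<open>det\<close>; it is
      recovered from the positive determinant.\<close>
    have "0 < ?D * L (x k) (y k)" using D1 by linarith
    hence "0 < ?D" using L0 by (simp add: zero_less_mult_iff)
    hence "0 < (2 * Q k * Q (k + 1) ^ 2) * C" using D by (simp add: mult_ac)
    moreover have "0 < 2 * Q k * Q (k + 1) ^ 2" using Q1[OF k1] X by simp
    ultimately have C0: "C > 0" by (simp only: zero_less_mult_pos)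
    have low: "Q k * L (x k) (y k) \<le> real p * X * L u v"
      using best_approx_seq_lower_bound[OF p \<xi> seq k1 _ uv(1,2)] X(2) by (simp add: Q_def L_def)
    note D1
    also have "?D * L (x k) (y k) \<le> (2 * C * Q k * Q (k + 1) ^ 2) * L (x k) (y k)"
      by (rule mult_right_mono[OF D L0])
    \<comment> \<open>The factor \<open>Q k\<close> of the determinant bound is exactly the one on
      the left of \<open>low\<close>, so no power of \<open>Q k\<close> is left over.\<close>
    also have "\<dots> = (2 * C * Q (k + 1) ^ 2) * (Q k * L (x k) (y k))" by simp
    also have "\<dots> \<le> (2 * C * (2 * X) ^ 2) * (real p * X * X powr (- \<mu>))"
    proof (rule mult_mono)
      show "2 * C * Q (k + 1) ^ 2 \<le> 2 * C * (2 * X) ^ 2"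
        using C0 X by (intro mult_left_mono power_mono) auto
      show "Q k * L (x k) (y k) \<le> real p * X * X powr (- \<mu>)"
        using low mult_left_mono[OF uv(3), of "real p * X"] X by simp
      show "0 \<le> Q k * L (x k) (y k)" using L0 Q1[OF k1] by simp
    qed (use C0 in simp)
    also have "\<dots> = 8 * C * real p * (X ^ 3 * X powr (- \<mu>))"
      by (simp add: power2_eq_square power3_eq_cube)
    also have "X ^ 3 * X powr (- \<mu>) = X powr (3 - \<mu>)"
      using X by (simp add: powr_diff powr_minus divide_inverse)
    finally show False using X0(1)[OF X(4)] by linarith
  qed
  thus ?thesis
    unfolding mu_hat_mult_def L_def by (intro Sup_least) auto
qed

end
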